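(* Let $\{P_n(x)\}_{n=0}^\infty$ be the sequence of monic orthogonal polynomials with respect to a quasi-definite linear functional $\mathcal{L}$. Let $\mathcal{U}_n^Q(x;a_1)=\mathcal{U}_n(x;a_1)+\alpha_n\mathcal{U}_{n-1}(x;a_1)$, with constants $\alpha_n$, be a monic quasi-Uvarov polynomial of order one for some $a_1\in\mathbb{R}$. Let $\{\mathcal{C}_n(x;a_2)\}_{n=0}^\infty$ be the sequence of monic orthogonal polynomials with respect to the Christoffel transformation $\mathcal{L}^C$ of $\mathcal{L}$ at $a_2\in\mathbb{R}$. Then there exist sequences of constants $\{\zeta_n\}_{n=0}^\infty$, $\{\gamma_n\}_{n=0}^\infty$ and $\{\eta_n\}_{n=0}^\infty$ such that $$P_{n-1}(x)=\frac{(x-\eta_n)(x-a_2)}{\zeta_nx-\gamma_n}\mathcal{C}_{n-1}(x;a_2)-\frac{x-a_1}{\zeta_nx-\gamma_n}\mathcal{U}_n^Q(x;a_1),\qquad n\ge1.$$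
   Context: A linear functional $\mathcal{L}$ on the polynomials with complex coefficients is quasi-definite if there is a sequence of monic polynomials $P_n$, $\deg P_n=n$, with $\mathcal{L}[P_nP_m]=0$ for $n\ne m$ and $\mathcal{L}[P_n^2]\ne0$. The Christoffel transformation of $\mathcal{L}$ at $a_2$ is $\mathcal{L}^C[p(x)]=\mathcal{L}[(x-a_2)p(x)]$; it is assumed quasi-definite, and its monic orthogonal polynomials (kernel polynomials) are $\mathcal{C}_n(x;a_2)=\frac{1}{x-a_2}\left[P_{n+1}(x)-\frac{P_{n+1}(a_2)}{P_n(a_2)}P_n(x)\right]$, $n\ge0$. The Uvarov transformation of $\mathcal{L}$ at $a_1$ with constant $M$ is $\mathcal{L}^U[p(x)]=\mathcal{L}[p(x)]+Mp(a_1)$; it is assumed quasi-definite, and $\mathcal{U}_n(x;a_1)$ denotes its monic orthogonal polynomial of degree $n$ (Uvarov polynomial).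
   Formalization: When n ≥ 2 and U_n^Q(x;a_1) = (x−a_2)C_{n−1}(x;a_2), the quotient formula fails (it forces ζ_n = γ_n = 0), so there only the identity multiplied through by ζ_n x − γ_n is asserted; in all other cases the denominator is not identically zero. *)

theory Defs
  imports "HOL-Computational_Algebra.Polynomial"
    "HOL.Complex"
begin

definition linear_functional :: "(complex poly \<Rightarrow> complex) \<Rightarrow> bool" where
  "linear_functional L \<longleftrightarrow> Vector_Spaces.linear smult (*) L"

definition monic_orthogonal_seq ::
    "(complex poly \<Rightarrow> complex) \<Rightarrow> (nat \<Rightarrow> complex poly) \<Rightarrow> bool" where
  "monic_orthogonal_seq L P \<longleftrightarrow>
     (\<forall>n. degree (P n) = n \<and> lead_coeff (P n) = 1) \<and>
     (\<forall>n m. n \<noteq> m \<longrightarrow> L (P n * P m) = 0) \<and>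
     (\<forall>n. L ((P n)\<^sup>2) \<noteq> 0)"

definition quasi_definite :: "(complex poly \<Rightarrow> complex) \<Rightarrow> bool" where
  "quasi_definite L \<longleftrightarrow> linear_functional L \<and> (\<exists>P. monic_orthogonal_seq L P)"

definition christoffel ::
    "complex \<Rightarrow> (complex poly \<Rightarrow> complex) \<Rightarrow> complex poly \<Rightarrow> complex" where
  "christoffel a L p = L ([:- a, 1:] * p)"

definition uvarov ::
    "complex \<Rightarrow> complex \<Rightarrow> (complex poly \<Rightarrow> complex) \<Rightarrow> complex poly \<Rightarrow> complex" where
  "uvarov a M L p = L p + M * poly p a"

(* The value at n = 0 follows the usual convention that the polynomial of index -1 is 0. *)
definition quasi_order_one ::
    "(nat \<Rightarrow> complex) \<Rightarrow> (nat \<Rightarrow> complex poly) \<Rightarrow> nat \<Rightarrow> complex poly" where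
  "quasi_order_one \<alpha> U n = (if n = 0 then U 0 else U n + smult (\<alpha> n) (U (n - 1)))"

end

theory Submission
  imports Defs
begin

text \<open>
  Both \<open>(x - a\<^sub>2) C\<^bsub>n-1\<^esub>\<close> and \<open>(x - a\<^sub>1) U\<^sup>Q\<^sub>n\<close> are orthogonal to many polynomials of low degree,
  so the former is \<open>P\<^sub>n + c P\<^bsub>n-1\<^esub>\<close> and the latter is \<open>(x + a) P\<^sub>n + (e x + b) P\<^bsub>n-1\<^esub>\<close>; eliminating
  \<open>P\<^sub>n\<close> gives the identity. If the factor \<open>\<zeta> x - \<gamma>\<close> vanished although
  \<open>U\<^sup>Q\<^sub>n \<noteq> (x - a\<^sub>2) C\<^bsub>n-1\<^esub>\<close>, then \<open>(x - a\<^sub>2) C\<^bsub>n-1\<^esub> = (x - a\<^sub>1) Q\<close> with \<open>Q\<close> of degree \<open>n - 1\<close>, and for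
  \<open>n \<ge> 2\<close> this \<open>Q\<close> would be orthogonal to itself and to all lower degrees for the Uvarov functional,
  which is impossible. For \<open>n = 1\<close> the constant \<open>\<eta>\<close> can be chosen freely.
\<close>

section \<open>Linearity and degree bookkeeping\<close>

lemma linear_functional_simps:
  assumes "linear_functional L"
  shows "L (p + q) = L p + L q" "L (p - q) = L p - L q" "L (smult c p) = c * L p" "L 0 = 0"
proof -
  interpret Vector_Spaces.linear smult "(*)" L
    using assms by (simp add: linear_functional_def)
  show "L (p + q) = L p + L q" "L (p - q) = L p - L q" "L (smult c p) = c * L p" "L 0 = 0"
    by (simp_all add: add diff scale)
qed

lemma degree_less_or_zero:
  fixes p :: "'a::zero poly"
  assumes "degree p \<le> n" "coeff p n = 0"
  shows "p = 0 \<or> degree p < n"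
  using assms by (metis le_neq_implies_less leading_coeff_0_iff)

text \<open>The factor \<open>x - a\<close> vanishes at \<open>a\<close>, so the point mass
  contributes nothing.\<close>

lemma uvarov_linear_factor: "uvarov a M L ([:- a, 1:] * p) = L ([:- a, 1:] * p)"
  by (simp add: uvarov_def)

section \<open>Expansions in a monic orthogonal sequence\<close>

context
  fixes L :: "complex poly \<Rightarrow> complex" and P :: "nat \<Rightarrow> complex poly"
  assumes lin: "linear_functional L" and orth: "monic_orthogonal_seq L P"
begin

lemma degree_P: "degree (P n) = n" and coeff_P: "coeff (P n) n = 1"
  and orth_P: "n \<noteq> m \<Longrightarrow> L (P n * P m) = 0" and norm_P: "L (P n * P n) \<noteq> 0"
  using orth unfolding monic_orthogonal_seq_def power2_eq_square by (blast, metis, blast, blast)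

lemma P_0: "P 0 = 1"
  using degree_P[of 0] coeff_P[of 0] by (metis degree_0_id lead_coeff_pCons(1) one_pCons)

lemma orthogonal_lower_degree:
  assumes "degree q < n"
  shows "L (P n * q) = 0"
proof -
  \<comment> \<open>Induction on a degree bound \<open>k\<close>: each step splits off the
    \<open>P k\<close> term, and \<open>k \<le> n\<close> keeps the removed indices below
    \<open>n\<close>.\<close>
  have "degree q < k \<Longrightarrow> L (P n * q) = 0" if "k \<le> n" for k q
    using that
  proof (induction k arbitrary: q)
    case (Suc k)
    define r where "r = q - smult (coeff q k) (P k)"
    have "r = 0 \<or> degree r < k"
      by (rule degree_less_or_zero) (use Suc.prems in \<open>auto simp: r_def coeff_P degree_P intro!: degree_diff_le\<close>)
    then have "L (P n * r) = 0"
      using Suc by (auto simp: linear_functional_simps[OF lin])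
    moreover have "P n * q = P n * r + smult (coeff q k) (P n * P k)"
      by (simp add: r_def algebra_simps)
    ultimately show ?case
      using Suc.prems orth_P[of n k] by (simp add: linear_functional_simps[OF lin])
  qed simp
  from this[of n q] assms show ?thesis by simp
qed

lemma functional_P_mult:
  assumes "degree q \<le> n"
  shows "L (P n * q) = coeff q n * L (P n * P n)"
proof -
  define r where "r = q - smult (coeff q n) (P n)"
  have "r = 0 \<or> degree r < n"
    by (rule degree_less_or_zero) (use assms in \<open>auto simp: r_def coeff_P degree_P intro!: degree_diff_le\<close>)
  then have "L (P n * r) = 0"
    using orthogonal_lower_degree by (auto simp: linear_functional_simps[OF lin])
  moreover have "P n * q = P n * r + smult (coeff q n) (P n * P n)"
    by (simp add: r_def algebra_simps)
  ultimately show ?thesis by (simp add: linear_functional_simps[OF lin])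
qed

text \<open>A nonzero remainder of degree \<open>d < n\<close> would be orthogonal to
  \<open>P d\<close>, yet pairing it with \<open>P d\<close> gives its leading coefficient times the
  nonzero norm of \<open>P d\<close>.\<close>

lemma eq_smult_P:
  assumes "degree R \<le> n" and ort: "\<And>p. degree p < n \<Longrightarrow> L (R * p) = 0"
  shows "R = smult (coeff R n) (P n)"
proof (rule ccontr)
  assume neq: "R \<noteq> smult (coeff R n) (P n)"
  define r where "r = R - smult (coeff R n) (P n)"
  define d where "d = degree r"
  have "r = 0 \<or> degree r < n"
    by (rule degree_less_or_zero) (use assms in \<open>auto simp: r_def coeff_P degree_P intro!: degree_diff_le\<close>)
  then have d: "d < n" "r \<noteq> 0" using neq by (auto simp: d_def r_def)
  have "r * P d = R * P d - smult (coeff R n) (P n * P d)"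
    by (simp add: r_def algebra_simps)
  then have "L (P d * r) = 0"
    using ort[of "P d"] orth_P[of n d] d
    by (simp add: linear_functional_simps[OF lin] degree_P mult.commute[of _ r])
  moreover have "L (P d * r) = coeff r d * L (P d * P d)"
    by (rule functional_P_mult) (simp add: d_def)
  ultimately show False using norm_P d by (simp add: d_def)
qed

lemma eq_smult_P_add_smult_P:
  assumes "degree R \<le> Suc n" and ort: "\<And>p. degree p < n \<Longrightarrow> L (R * p) = 0"
  shows "\<exists>b. R = smult (coeff R (Suc n)) (P (Suc n)) + smult b (P n)"
proof -
  let ?c = "coeff R (Suc n)"
  define r where "r = R - smult ?c (P (Suc n))"
  have "r = 0 \<or> degree r < Suc n"
    by (rule degree_less_or_zero) (use assms in \<open>auto simp: r_def coeff_P degree_P intro!: degree_diff_le\<close>)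
  then have "degree r \<le> n" by auto
  moreover have "L (r * p) = 0" if "degree p < n" for p
  proof -
    have "r * p = R * p - smult ?c (P (Suc n) * p)"
      by (simp add: r_def algebra_simps)
    then show ?thesis
      using ort[OF that] orthogonal_lower_degree[of p "Suc n"] that
      by (simp add: linear_functional_simps[OF lin])
  qed
  ultimately have "r = smult (coeff r n) (P n)" by (rule eq_smult_P)
  then have "R = smult ?c (P (Suc n)) + smult (coeff r n) (P n)"
    by (simp add: r_def algebra_simps)
  then show ?thesis ..
qed

lemma monic_not_self_orthogonal:
  assumes "degree R \<le> n" "coeff R n = 1" "\<And>p. degree p \<le> n \<Longrightarrow> L (R * p) = 0"
  shows False
proof -
  have "R = smult (coeff R n) (P n)" using assms by (intro eq_smult_P) auto
  then have "R = P n" using assms(2) by simp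
  then show False using norm_P[of n] assms by (simp add: degree_P)
qed

text \<open>The \<open>P\<^sub>m\<close>-term of an expansion in \<open>P\<^bsub>m+3\<^esub>, \<dots>, P\<^sub>m\<close> is absorbed into the coefficient \<open>e x\<close> of
  \<open>P\<^bsub>m+1\<^esub>\<close>, since \<open>x P\<^bsub>m+1\<^esub>\<close> has a nonzero \<open>P\<^sub>m\<close>-component.\<close>

lemma expansion_linear_coeffs:
  assumes deg: "degree W = m + 3" "lead_coeff W = 1"
    and ort: "\<And>p. degree p < m \<Longrightarrow> L (W * p) = 0"
  shows "\<exists>a e b. W = [:a, 1:] * P (m + 2) + [:b, e:] * P (m + 1)"
proof -
  let ?X = "[:0, 1:] :: complex poly"
  define k where "k = L (?X * P (m + 1) * P m)"
  have "L (P (m + 1) * (?X * P m)) = coeff (?X * P m) (m + 1) * L (P (m + 1) * P (m + 1))"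
    by (rule functional_P_mult) (auto intro: order_trans[OF degree_mult_le] simp: degree_P)
  then have k: "k \<noteq> 0"
    using norm_P[of "m + 1"] by (simp add: k_def coeff_P mult_ac)
  \<comment> \<open>This value makes \<open>R\<close> orthogonal to \<open>P m\<close>; the divisor
    \<open>k\<close> is nonzero because it equals the norm of \<open>P (m + 1)\<close>.\<close>
  define e where "e = L (W * P m) / k"
  define R where "R = W - ?X * P (m + 2) - smult e (?X * P (m + 1))"
  have "degree R \<le> m + 3"
    unfolding R_def
    by (intro degree_diff_le order_trans[OF degree_smult_le] order_trans[OF degree_mult_le])
      (auto simp: deg degree_P)
  \<comment> \<open>\<open>W\<close> and \<open>x P (m + 2)\<close> are both monic of degree
    \<open>m + 3\<close>, so their leading terms cancel.\<close>
  moreover have "coeff R (m + 3) = 0"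
    using deg coeff_P[of "m + 2"] degree_P[of "m + 1"]
    by (auto simp: R_def numeral_3_eq_3 coeff_eq_0)
  ultimately have "R = 0 \<or> degree R < m + 3" by (rule degree_less_or_zero)
  then have dR: "degree R \<le> Suc (m + 1)" by auto
  have split: "L (R * p) = L (W * p) - L (P (m + 2) * (?X * p)) - e * L (P (m + 1) * (?X * p))" for p
  proof -
    have "R * p = W * p - P (m + 2) * (?X * p) - smult e (P (m + 1) * (?X * p))"
      by (simp add: R_def algebra_simps)
    then show ?thesis by (simp only: linear_functional_simps[OF lin])
  qed
  have dX: "degree (?X * p) \<le> degree p + 1" for p :: "complex poly"
    by (rule order_trans[OF degree_mult_le]) simp
  have low: "L (R * p) = 0" if "degree p < m" for p
    using that ort[of p] dX[of p] orthogonal_lower_degree[of "?X * p"] by (simp add: split)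
  have RPm: "L (R * P m) = 0"
    using orthogonal_lower_degree[of "?X * P m" "m + 2"] dX[of "P m"] k degree_P[of m]
    by (simp add: split e_def k_def mult_ac)
  \<comment> \<open>One more degree of orthogonality is gained by splitting off the
    \<open>P m\<close> component of \<open>p\<close>.\<close>
  have "L (R * p) = 0" if "degree p < m + 1" for p
  proof -
    define r where "r = p - smult (coeff p m) (P m)"
    have "r = 0 \<or> degree r < m"
      by (rule degree_less_or_zero) (use that in \<open>auto simp: r_def coeff_P degree_P intro!: degree_diff_le\<close>)
    then have "L (R * r) = 0" using low by (auto simp: linear_functional_simps[OF lin])
    moreover have "R * p = R * r + smult (coeff p m) (R * P m)"
      by (simp add: r_def algebra_simps)
    ultimately show ?thesis using RPm by (simp add: linear_functional_simps[OF lin])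
  qed
  with dR obtain b where b: "R = smult (coeff R (m + 2)) (P (m + 2)) + smult b (P (m + 1))"
    using eq_smult_P_add_smult_P[of R "m + 1"] by auto
  have "W = R + smult e (?X * P (m + 1)) + ?X * P (m + 2)"
    unfolding R_def by (simp only: diff_add_cancel)
  also have "\<dots> = [:coeff R (m + 2), 1:] * P (m + 2) + [:b, e:] * P (m + 1)"
    by (subst (1) b) simp
  finally show ?thesis by blast
qed

end

section \<open>Quasi-Uvarov and kernel polynomials\<close>

lemma quasi_order_one_Suc: "quasi_order_one \<alpha> U (Suc n) = U (Suc n) + smult (\<alpha> (Suc n)) (U n)"
  by (simp add: quasi_order_one_def)

lemma quasi_order_one_monic:
  assumes "linear_functional L" "monic_orthogonal_seq L U"
  shows "degree (quasi_order_one \<alpha> U (Suc n)) = Suc n"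
    and "lead_coeff (quasi_order_one \<alpha> U (Suc n)) = 1"
proof -
  have "degree (smult (\<alpha> (Suc n)) (U n)) < degree (U (Suc n))"
    using degree_P[OF assms] le_less_trans[OF degree_smult_le] by simp
  then show "degree (quasi_order_one \<alpha> U (Suc n)) = Suc n"
    and "lead_coeff (quasi_order_one \<alpha> U (Suc n)) = 1"
    using degree_P[OF assms, of "Suc n"] degree_P[OF assms, of n] coeff_P[OF assms, of "Suc n"]
    by (simp_all add: quasi_order_one_Suc degree_add_eq_left coeff_eq_0)
qed

lemma quasi_order_one_orthogonal:
  assumes "linear_functional L" "monic_orthogonal_seq L U" "degree p < n"
  shows "L (quasi_order_one \<alpha> U (Suc n) * p) = 0"
  using orthogonal_lower_degree[OF assms(1,2), of p "Suc n"]
    orthogonal_lower_degree[OF assms(1,2), of p n] assms(3)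
  by (simp add: quasi_order_one_Suc distrib_right linear_functional_simps[OF assms(1)])

text \<open>Pairing \<open>(x - a) C n\<close> with \<open>p\<close> under \<open>L\<close> is
  pairing \<open>C n\<close> with \<open>p\<close> under the Christoffel functional, so all degrees
  below \<open>n\<close> are annihilated.\<close>

lemma kernel_polynomial_expansion:
  assumes L: "linear_functional L" "monic_orthogonal_seq L P"
    and C: "linear_functional (christoffel a L)" "monic_orthogonal_seq (christoffel a L) C"
  shows "\<exists>c. [:- a, 1:] * C n = P (Suc n) + smult c (P n)"
proof -
  have "degree ([:- a, 1:] * C n) \<le> Suc n"
    by (rule order_trans[OF degree_mult_le]) (simp add: degree_P[OF C])
  moreover have "L ([:- a, 1:] * C n * p) = 0" if "degree p < n" for p
    using orthogonal_lower_degree[OF C that] by (simp only: christoffel_def mult.assoc)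
  ultimately obtain c where "[:- a, 1:] * C n =
      smult (coeff ([:- a, 1:] * C n) (Suc n)) (P (Suc n)) + smult c (P n)"
    using eq_smult_P_add_smult_P[OF L] by blast
  moreover have "coeff ([:- a, 1:] * C n) (Suc n) = 1"
    using coeff_P[OF C, of n] degree_P[OF C, of n] by (simp add: coeff_eq_0)
  ultimately show ?thesis by (metis smult_1_left)
qed

text \<open>The case \<open>\<zeta> = \<gamma> = 0\<close>. Polynomials of degree at most \<open>n + 1\<close> are split as a constant plus a
  multiple of \<open>x - a\<^sub>1\<close>; on the latter the Uvarov functional agrees with \<open>L\<close>.\<close>

lemma quasi_uvarov_eq_christoffel:
  assumes U: "linear_functional (uvarov a1 M L)" "monic_orthogonal_seq (uvarov a1 M L) U"
    and C: "linear_functional (christoffel a2 L)" "monic_orthogonal_seq (christoffel a2 L) C"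
    and eq: "[:- \<eta>, 1:] * ([:- a2, 1:] * C (Suc n)) =
      [:- a1, 1:] * quasi_order_one \<alpha> U (Suc (Suc n))"
  shows "quasi_order_one \<alpha> U (Suc (Suc n)) = [:- a2, 1:] * C (Suc n)"
proof (cases "\<eta> = a1")
  case True
  then show ?thesis using eq by (metis mult_left_cancel one_neq_zero pCons_eq_0_iff)
next
  case False
  let ?V = "quasi_order_one \<alpha> U (Suc (Suc n))" and ?L = "uvarov a1 M L"
  \<comment> \<open>As \<open>\<eta>\<close> differs from \<open>a1\<close>, the root
    \<open>a1\<close> of the right side of \<open>eq\<close> must be a root of
    \<open>(x - a2) C (Suc n)\<close>.\<close>
  have "poly ([:- \<eta>, 1:] * ([:- a2, 1:] * C (Suc n))) a1 = 0"
    unfolding eq by simp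
  then have "poly ([:- a2, 1:] * C (Suc n)) a1 = 0"
    using False by simp
  then obtain Q where Q: "[:- a2, 1:] * C (Suc n) = [:- a1, 1:] * Q"
    by (metis dvdE poly_eq_0_iff_dvd)
  have "[:- a1, 1:] * ?V = [:- a1, 1:] * ([:- \<eta>, 1:] * Q)"
    unfolding eq[symmetric] Q by (simp only: mult.left_commute)
  then have V: "?V = [:- \<eta>, 1:] * Q"
    by (metis mult_left_cancel one_neq_zero pCons_eq_0_iff)
  then have "Q \<noteq> 0"
    using quasi_order_one_monic(1)[OF U, of \<alpha> "Suc n"] by auto
  then have "degree ?V = Suc (degree Q)"
    unfolding V by (subst degree_mult_eq) auto
  moreover have "lead_coeff ?V = lead_coeff Q"
    unfolding V lead_coeff_mult by simp
  ultimately have dQ: "degree Q = Suc n" "coeff Q (Suc n) = 1"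
    using quasi_order_one_monic[OF U, of \<alpha> "Suc n"] by auto
  have ort: "?L ([:- a1, 1:] * (Q * p)) = 0" if "degree p < Suc n" for p
  proof -
    have "?L ([:- a1, 1:] * (Q * p)) = L ([:- a1, 1:] * Q * p)"
      unfolding uvarov_linear_factor by (simp only: mult.assoc)
    also have "\<dots> = christoffel a2 L (C (Suc n) * p)"
      unfolding Q[symmetric] christoffel_def by (simp only: mult.assoc)
    also have "\<dots> = 0" using that by (rule orthogonal_lower_degree[OF C])
    finally show ?thesis .
  qed
  have "?V = [:- a1, 1:] * (Q * 1) + smult (a1 - \<eta>) Q"
    by (simp add: V algebra_simps smult_diff_left)
  \<comment> \<open>Both Uvarov polynomials in \<open>?V\<close> have positive index, hence are
    orthogonal to \<open>1\<close>; this would fail for a quasi-Uvarov polynomial of index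
    one.\<close>
  moreover have "?L ?V = 0"
    using quasi_order_one_orthogonal[OF U, of 1 "Suc n"] by simp
  ultimately have "?L Q = 0"
    using ort[of 1] False by (simp add: linear_functional_simps[OF U(1)])
  have "?L (Q * p) = 0" if "degree p \<le> Suc n" for p
  proof -
    have "degree (synthetic_div p a1) < Suc n"
      using that by (simp add: degree_synthetic_div)
    moreover have "Q * p = [:- a1, 1:] * (Q * synthetic_div p a1) + smult (poly p a1) Q"
      by (subst (1) synthetic_div_correct'[of a1 p, symmetric]) (simp add: algebra_simps)
    ultimately show ?thesis
      using ort \<open>?L Q = 0\<close> by (simp add: linear_functional_simps[OF U(1)])
  qed
  then show ?thesis
    using monic_not_self_orthogonal[OF U, of Q "Suc n"] dQ by auto
qed

text \<open>The identity with denominators cleared and the index shifted, \<open>n\<close> standing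
  for \<open>n - 1\<close>. If the quasi-Uvarov polynomial equals \<open>(x - a2) C n\<close>, the
  right side vanishes at \<open>\<eta> = a1\<close>, whence the exception in the last
  clause.\<close>

lemma quasi_uvarov_christoffel_relation:
  assumes L: "linear_functional L" "monic_orthogonal_seq L P"
    and U: "linear_functional (uvarov a1 M L)" "monic_orthogonal_seq (uvarov a1 M L) U"
    and C: "linear_functional (christoffel a2 L)" "monic_orthogonal_seq (christoffel a2 L) C"
  shows "\<exists>\<zeta> \<gamma> \<eta>. [:- \<gamma>, \<zeta>:] * P n = [:- \<eta>, 1:] * ([:- a2, 1:] * C n)
        - [:- a1, 1:] * quasi_order_one \<alpha> U (Suc n) \<and>
      (n = 0 \<or> quasi_order_one \<alpha> U (Suc n) \<noteq> [:- a2, 1:] * C n \<longrightarrow> \<zeta> \<noteq> 0 \<or> \<gamma> \<noteq> 0)"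
proof (cases n)
  case 0
  let ?V = "quasi_order_one \<alpha> U 1"
  define v where "v = coeff ?V 0"
  have "degree ?V = 1" "coeff ?V 1 = 1"
    using quasi_order_one_monic[OF U, of \<alpha> 0] by auto
  then have V: "?V = [:v, 1:]"
    by (intro poly_eqI) (auto simp: v_def coeff_pCons coeff_eq_0 split: nat.split)
  \<comment> \<open>The right side is linear here, its quadratic terms cancelling; this
    \<open>\<eta>\<close> makes the coefficient of \<open>x\<close> equal to
    \<open>1\<close>.\<close>
  define \<eta> where "\<eta> = a1 - v - a2 - 1"
  have "[:- (- \<eta> * a2 - a1 * v), 1:] * P 0 = [:- \<eta>, 1:] * ([:- a2, 1:] * C 0) - [:- a1, 1:] * ?V"
    unfolding V P_0[OF L] P_0[OF C] by (simp add: \<eta>_def algebra_simps)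
  then show ?thesis using 0 by (metis One_nat_def one_neq_zero)
next
  case (Suc m)
  let ?V = "quasi_order_one \<alpha> U (Suc n)"
  obtain c where c: "[:- a2, 1:] * C n = P (Suc n) + smult c (P n)"
    using kernel_polynomial_expansion[OF L C] by blast
  have "?V \<noteq> 0" using quasi_order_one_monic(1)[OF U, of \<alpha> n] by auto
  then have "degree ([:- a1, 1:] * ?V) = m + 3"
    using quasi_order_one_monic(1)[OF U, of \<alpha> n] Suc by (subst degree_mult_eq) auto
  moreover have "lead_coeff ([:- a1, 1:] * ?V) = 1"
    using quasi_order_one_monic(2)[OF U, of \<alpha> n] unfolding lead_coeff_mult by simp
  moreover have "L ([:- a1, 1:] * ?V * p) = 0" if "degree p < m" for p
  proof -
    \<comment> \<open>Moving \<open>x - a1\<close> onto the test polynomial costs one degree of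
      orthogonality.\<close>
    have "degree ([:- a1, 1:] * p) < n"
      using that Suc degree_mult_le[of "[:- a1, 1:]" p] by simp
    then have "uvarov a1 M L (?V * ([:- a1, 1:] * p)) = 0"
      by (rule quasi_order_one_orthogonal[OF U])
    moreover have "?V * ([:- a1, 1:] * p) = [:- a1, 1:] * (?V * p)"
      by (rule mult.left_commute)
    ultimately show ?thesis by (metis uvarov_linear_factor mult.assoc)
  qed
  ultimately obtain a e b
    where "[:- a1, 1:] * ?V = [:a, 1:] * P (m + 2) + [:b, e:] * P (m + 1)"
    using expansion_linear_coeffs[OF L, of "[:- a1, 1:] * ?V" m] by blast
  then have W: "[:- a1, 1:] * ?V = [:a, 1:] * P (Suc n) + [:b, e:] * P n"
    using Suc by simp
  \<comment> \<open>Multiplying the kernel expansion by \<open>x + a\<close>, that is taking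
    \<open>\<eta> = - a\<close>, cancels the \<open>P (Suc n)\<close> terms.\<close>
  have "[:- (b - c * a), c - e:] * P n = [:- (- a), 1:] * ([:- a2, 1:] * C n) - [:- a1, 1:] * ?V"
    unfolding W c by (simp add: algebra_simps smult_add_left smult_diff_left)
  moreover have "?V = [:- a2, 1:] * C n" if "c - e = 0" "b - c * a = 0"
    using quasi_uvarov_eq_christoffel[OF U C, of "- a" m \<alpha>] calculation that Suc by simp
  ultimately show ?thesis using Suc by blast
qed

section \<open>Choice of the constant sequences and division by the linear factor\<close>

theorem theorem4p3:
  fixes L :: "complex poly \<Rightarrow> complex"
    and P U C :: "nat \<Rightarrow> complex poly"
    and \<alpha> :: "nat \<Rightarrow> complex"
    and a1 a2 :: real
    and M :: complex
  assumes "quasi_definite L"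
    and "monic_orthogonal_seq L P"
    and "quasi_definite (uvarov (of_real a1) M L)"
    and "monic_orthogonal_seq (uvarov (of_real a1) M L) U"
    and "quasi_definite (christoffel (of_real a2) L)"
    and "monic_orthogonal_seq (christoffel (of_real a2) L) C"
  shows "\<exists>\<zeta> \<gamma> \<eta> :: nat \<Rightarrow> complex. \<forall>n\<ge>1.
    (\<forall>x. \<zeta> n * x - \<gamma> n \<noteq> 0 \<longrightarrow>
       poly (P (n - 1)) x =
         (x - \<eta> n) * (x - of_real a2) / (\<zeta> n * x - \<gamma> n) * poly (C (n - 1)) x
         - (x - of_real a1) / (\<zeta> n * x - \<gamma> n) * poly (quasi_order_one \<alpha> U n) x) \<and>
    (\<forall>x. (\<zeta> n * x - \<gamma> n) * poly (P (n - 1)) x =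
         (x - \<eta> n) * (x - of_real a2) * poly (C (n - 1)) x
         - (x - of_real a1) * poly (quasi_order_one \<alpha> U n) x) \<and>
    (n = 1 \<or> quasi_order_one \<alpha> U n \<noteq> [:- of_real a2, 1:] * C (n - 1) \<longrightarrow>
       \<zeta> n \<noteq> 0 \<or> \<gamma> n \<noteq> 0)"
proof -
  have L: "linear_functional L" "linear_functional (uvarov (of_real a1) M L)"
      "linear_functional (christoffel (of_real a2) L)"
    using assms by (auto simp: quasi_definite_def)
  define R where "R \<zeta> \<gamma> \<eta> n \<longleftrightarrow>
      [:- \<gamma>, \<zeta>:] * P (n - 1) = [:- \<eta>, 1:] * ([:- of_real a2, 1:] * C (n - 1))
        - [:- of_real a1, 1:] * quasi_order_one \<alpha> U n \<and>
      (n = 1 \<or> quasi_order_one \<alpha> U n \<noteq> [:- of_real a2, 1:] * C (n - 1) \<longrightarrow> \<zeta> \<noteq> 0 \<or> \<gamma> \<noteq> 0)"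
    for \<zeta> \<gamma> \<eta> n
  \<comment> \<open>The guard sits inside the existentials so that choice yields total sequences,
    unconstrained at \<open>0\<close>.\<close>
  have "\<forall>n. \<exists>\<zeta> \<gamma> \<eta>. n \<ge> 1 \<longrightarrow> R \<zeta> \<gamma> \<eta> n"
  proof
    fix n
    show "\<exists>\<zeta> \<gamma> \<eta>. n \<ge> 1 \<longrightarrow> R \<zeta> \<gamma> \<eta> n"
      using quasi_uvarov_christoffel_relation[OF L(1) assms(2) L(2) assms(4) L(3) assms(6),
          of "n - 1" \<alpha>]
      by (cases n) (auto simp: R_def)
  qed
  then obtain \<zeta> \<gamma> \<eta> where R: "R (\<zeta> n) (\<gamma> n) (\<eta> n) n" if "n \<ge> 1" for n
    by metis
  show ?thesis
  proof (intro exI allI impI)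
    fix n :: nat
    assume "n \<ge> 1"
    note Rn = R[OF this, unfolded R_def]
    have id: "(\<zeta> n * x - \<gamma> n) * poly (P (n - 1)) x =
         (x - \<eta> n) * (x - of_real a2) * poly (C (n - 1)) x
         - (x - of_real a1) * poly (quasi_order_one \<alpha> U n) x" for x
      using arg_cong[OF conjunct1[OF Rn], of "\<lambda>p. poly p x"] by (simp add: algebra_simps)
    have "poly (P (n - 1)) x =
         (x - \<eta> n) * (x - of_real a2) / (\<zeta> n * x - \<gamma> n) * poly (C (n - 1)) x
         - (x - of_real a1) / (\<zeta> n * x - \<gamma> n) * poly (quasi_order_one \<alpha> U n) x"
      if "\<zeta> n * x - \<gamma> n \<noteq> 0" for x
      using id[of x] that by (simp add: nonzero_eq_divide_eq mult.commute flip: diff_divide_distrib)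
    with id conjunct2[OF Rn]
    show "(\<forall>x. \<zeta> n * x - \<gamma> n \<noteq> 0 \<longrightarrow>
       poly (P (n - 1)) x =
         (x - \<eta> n) * (x - of_real a2) / (\<zeta> n * x - \<gamma> n) * poly (C (n - 1)) x
         - (x - of_real a1) / (\<zeta> n * x - \<gamma> n) * poly (quasi_order_one \<alpha> U n) x) \<and>
      (\<forall>x. (\<zeta> n * x - \<gamma> n) * poly (P (n - 1)) x =
         (x - \<eta> n) * (x - of_real a2) * poly (C (n - 1)) x
         - (x - of_real a1) * poly (quasi_order_one \<alpha> U n) x) \<and>
      (n = 1 \<or> quasi_order_one \<alpha> U n \<noteq> [:- of_real a2, 1:] * C (n - 1) \<longrightarrow>
       \<zeta> n \<noteq> 0 \<or> \<gamma> n \<noteq> 0)"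
      by blast
  qed
qed

end
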